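(* Let $\mathcal{H}$ be a real Hilbert space and let $M_1,\dots,M_n$ be closed affine subspaces of $\mathcal{H}$ with $M:=\bigcap_{i=1}^n M_i\neq\emptyset$. For $i\in\{1,\dots,n\}$, let $M_i'$ denote the linear subspace parallel to $M_i$. Let $Q_0:=I$, $Q_i:=P_{M_i}\cdots P_{M_1}$ for $i\in\{1,\dots,n\}$, and $Q:=Q_n$. Let $x_0\in\mathcal{H}$ and let $(x_k)_{k\in\mathbb{N}}$ be the sequence defined by $$x_{k+1}:=x_k+t_k\bigl(Q(x_k)-x_k\bigr),\qquad t_k:=\begin{cases}\dfrac12+\dfrac{\sum_{i=1}^n\|Q_{i-1}(x_k)-Q_i(x_k)\|^2}{2\|x_k-Q(x_k)\|^2} & \text{if } Q(x_k)\neq x_k,\\[2mm] 1 & \text{otherwise,}\end{cases}$$ for $k=0,1,2,\dots$. Then there exists a sequence $(f_k)\subseteq[0,1]$ such that $$\|x_k-P_M(x_0)\|\leq \|x_0-P_M(x_0)\|\left(\prod_{i=1}^k f_i\right)c^k\qquad\forall k\in\mathbb{N},$$ where the constant $c\in[0,1]$ is given by $$c:=\left(1-\prod_{i=1}^{n-1}(1-c_i^2)\right)^{1/2}\quad\text{with}\quad c_i:=c\left(M_i',\bigcap_{j=i+1}^n M_j'\right).$$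
   Context: $\langle\cdot,\cdot\rangle$ and $\|\cdot\|$ denote the inner product and induced norm of $\mathcal{H}$; $I$ is the identity operator; $\mathbb{N}=\{0,1,2,\dots\}$. For a nonempty closed convex set $S\subseteq\mathcal{H}$, $P_S:\mathcal{H}\to S$ denotes the nearest point projector, $P_S(x)=\arg\min_{z\in S}\|x-z\|$. The linear subspace parallel to a nonempty affine subspace $S$ is $S'=S-y$ for any $y\in S$. For closed linear subspaces $A,B$ of $\mathcal{H}$, $c(A,B)$ denotes the cosine of the Friedrichs angle between $A$ and $B$, that is, $$c(A,B):=\sup\{|\langle a,b\rangle| : a\in A\cap(A\cap B)^\perp,\ b\in B\cap(A\cap B)^\perp,\ \|a\|=\|b\|=1\},$$ which is taken to be $0$ if the set over which the supremum is taken is empty. Here $\perp$ denotes orthogonal complement. *)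

theory Defs
  imports "HOL-Analysis.Analysis"
begin

(* The library's closest_point is restricted to class heine_borel, i.e. excludes
   infinite-dimensional Hilbert spaces. *)
definition nearest_point :: "'a::real_inner set \<Rightarrow> 'a \<Rightarrow> 'a" where
  "nearest_point S x = arg_min_on (\<lambda>z. norm (x - z)) S"

(* S - y for an arbitrary y in S; see parallel_subspace_eq for independence of the choice. *)
definition parallel_subspace :: "'a::real_vector set \<Rightarrow> 'a set" where
  "parallel_subspace S = (\<lambda>x. x - (SOME y. y \<in> S)) ` S"

lemma parallel_subspace_eq:
  assumes "affine S" and "y \<in> S"
  shows "parallel_subspace S = (\<lambda>x. x - y) ` S"
proof -
  have shift: "(\<lambda>x. x - u) ` S \<subseteq> (\<lambda>x. x - v) ` S" if "u \<in> S" "v \<in> S" for u v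
  proof
    fix w assume "w \<in> (\<lambda>x. x - u) ` S"
    then obtain x where x: "x \<in> S" "w = x - u" by auto
    have "v + 1 *\<^sub>R (x - u) \<in> S"
      using mem_affine_3_minus[OF assms(1) that(2) x(1) that(1)] .
    then have "v + w \<in> S" using x by simp
    then show "w \<in> (\<lambda>x. x - v) ` S" by (rule rev_image_eqI) simp
  qed
  have "(SOME y. y \<in> S) \<in> S" using assms(2) by (rule someI)
  then show ?thesis
    unfolding parallel_subspace_def using shift assms(2) by blast
qed

definition friedrichs_set :: "'a::real_inner set \<Rightarrow> 'a set \<Rightarrow> real set" where
  "friedrichs_set A B =
    {\<bar>a \<bullet> b\<bar> | a b. a \<in> A \<inter> (A \<inter> B)\<^sup>\<bottom> \<and> b \<in> B \<inter> (A \<inter> B)\<^sup>\<bottom> \<and> norm a = 1 \<and> norm b = 1}"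

definition friedrichs_cos :: "'a::real_inner set \<Rightarrow> 'a set \<Rightarrow> real" where
  "friedrichs_cos A B = (if friedrichs_set A B = {} then 0 else Sup (friedrichs_set A B))"

(* proj_comp M i = P_{M_i} ... P_{M_1}; the value M 0 is never used. *)
primrec proj_comp :: "(nat \<Rightarrow> 'a::real_inner set) \<Rightarrow> nat \<Rightarrow> 'a \<Rightarrow> 'a" where
  "proj_comp M 0 = id"
| "proj_comp M (Suc i) = nearest_point (M (Suc i)) \<circ> proj_comp M i"

definition step_size :: "(nat \<Rightarrow> 'a::real_inner set) \<Rightarrow> nat \<Rightarrow> 'a \<Rightarrow> real" where
  "step_size M n x =
    (if proj_comp M n x \<noteq> x
     then 1 / 2 + (\<Sum>i=1..n. (norm (proj_comp M (i - 1) x - proj_comp M i x))\<^sup>2)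
                  / (2 * (norm (x - proj_comp M n x))\<^sup>2)
     else 1)"

definition angle_cos :: "(nat \<Rightarrow> 'a::real_inner set) \<Rightarrow> nat \<Rightarrow> nat \<Rightarrow> real" where
  "angle_cos M n i =
    friedrichs_cos (parallel_subspace (M i)) (\<Inter>j\<in>{i+1..n}. parallel_subspace (M j))"

definition rate_const :: "(nat \<Rightarrow> 'a::real_inner set) \<Rightarrow> nat \<Rightarrow> real" where
  "rate_const M n = sqrt (1 - (\<Prod>i=1..n-1. (1 - (angle_cos M n i)\<^sup>2)))"

end

theory Submission
  imports Defs
begin

text \<open>
  The proof rests on two facts about one step from a point \<open>x\<close> with \<open>P\<^sub>M x = m\<close>.

  First, the step size is exact line search for the distance to \<open>m\<close>. Since \<open>m\<close> lies in every
  \<open>M\<^sub>i\<close>, Pythagoras applied along the orbit \<open>Q\<^sub>0 x, Q\<^sub>1 x, \<dots>, Q\<^sub>n x\<close> shows that the sum of the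
  squared increments is \<open>\<parallel>x - m\<parallel>\<^sup>2 - \<parallel>Q x - m\<parallel>\<^sup>2\<close>. Hence \<open>t\<close> is a minimiser of
  \<open>s \<mapsto> \<parallel>x + s (Q x - x) - m\<parallel>\<close>, and the accelerated step is at least as close to \<open>m\<close> as the plain
  step \<open>Q x\<close> (\<open>line_search_step_le\<close>).

  Secondly, cyclic projections contract by the constant \<open>c\<close> on the orthogonal complement of the
  intersection of the parallel subspaces (\<open>cyclic_projection_contraction\<close>). This goes by induction
  on the number of subspaces. Put \<open>N = \<Inter>\<^bsub>j>1\<^esub> M\<^sub>j'\<close> and split \<open>w = P\<^sub>1 y\<close> as \<open>w\<^sub>1 + w\<^sub>2\<close> with
  \<open>w\<^sub>1 \<in> N\<close> and \<open>w\<^sub>2 \<in> N\<^sup>\<bottom>\<close>. The remaining projections fix \<open>w\<^sub>1\<close> and contract \<open>w\<^sub>2\<close> within \<open>N\<^sup>\<bottom>\<close> by the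
  induction hypothesis, while the Friedrichs angle gives \<open>\<parallel>w\<^sub>1\<parallel> \<le> c\<^sub>1 \<parallel>w\<parallel>\<close>.

  The differences \<open>x\<^sub>k - m\<close> stay in that orthogonal complement, so the two facts combine at every
  step and give \<open>\<parallel>x\<^sub>k - m\<parallel> \<le> c\<^sup>k \<parallel>x\<^sub>0 - m\<parallel>\<close>. In particular the constant sequence \<open>f = 1\<close> is a
  witness.
\<close>

section \<open>Nearest points in closed affine subspaces\<close>

lemma orthogonal_comp_iff: "x \<in> S\<^sup>\<bottom> \<longleftrightarrow> (\<forall>y\<in>S. x \<bullet> y = 0)"
  by (auto simp: orthogonal_comp_def orthogonal_def inner_commute)

lemma norm_add_sq: "(norm (a + b :: 'a::real_inner))\<^sup>2 = (norm a)\<^sup>2 + 2 * (a \<bullet> b) + (norm b)\<^sup>2"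
  by (simp add: dot_norm field_simps)

lemma exists_nearest_point:
  fixes S :: "'a::{real_inner, complete_space} set"
  assumes "convex S" "closed S" "S \<noteq> {}"
  shows "\<exists>p\<in>S. \<forall>z\<in>S. norm (x - p) \<le> norm (x - z)"
proof -
  define d where "d = Inf ((\<lambda>z. (norm (x - z))\<^sup>2) ` S)"
  have bdd: "bdd_below ((\<lambda>z. (norm (x - z))\<^sup>2) ` S)"
    by (rule bdd_belowI[of _ 0]) auto
  have d_le: "d \<le> (norm (x - z))\<^sup>2" if "z \<in> S" for z
    unfolding d_def using that bdd by (intro cInf_lower) auto
  have "\<exists>z\<in>S. (norm (x - z))\<^sup>2 < d + 1 / real (Suc k)" for k
  proof -
    have "Inf ((\<lambda>z. (norm (x - z))\<^sup>2) ` S) < d + 1 / real (Suc k)"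
      unfolding d_def[symmetric] by simp
    then show ?thesis using cInf_lessD[of "(\<lambda>z. (norm (x - z))\<^sup>2) ` S"] assms(3) by blast
  qed
  then obtain z where zS: "\<And>k. z k \<in> S"
    and zd: "\<And>k. (norm (x - z k))\<^sup>2 < d + 1 / real (Suc k)" by metis
  \<comment> \<open>The parallelogram law, with the midpoint again in \<open>S\<close>, makes a minimising sequence Cauchy.\<close>
  have gap: "(norm (z j - z k))\<^sup>2 < 2 / real (Suc j) + 2 / real (Suc k)" for j k
  proof -
    have "(1/2) *\<^sub>R z j + (1/2) *\<^sub>R z k \<in> S"
      using assms(1) zS by (simp add: convex_def)
    then have mid: "d \<le> (norm (x - ((1/2) *\<^sub>R z j + (1/2) *\<^sub>R z k)))\<^sup>2" by (rule d_le)
    have "(norm (z j - z k))\<^sup>2 = 2 * (norm (x - z j))\<^sup>2 + 2 * (norm (x - z k))\<^sup>2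
        - 4 * (norm (x - ((1/2) *\<^sub>R z j + (1/2) *\<^sub>R z k)))\<^sup>2"
      by (simp add: power2_norm_eq_inner inner_diff_left inner_diff_right inner_add_left
          inner_add_right inner_commute algebra_simps)
    then show ?thesis using mid zd[of j] zd[of k] by linarith
  qed
  have "Cauchy z"
  proof (rule metric_CauchyI)
    fix e :: real assume "e > 0"
    then obtain K where K: "1 / real (Suc K) < e\<^sup>2 / 4"
      using nat_approx_posE[of "e\<^sup>2 / 4"] by auto
    have "dist (z j) (z k) < e" if "j \<ge> K" "k \<ge> K" for j k
    proof -
      have "1 / real (Suc j) \<le> 1 / real (Suc K)" "1 / real (Suc k) \<le> 1 / real (Suc K)"
        using that by (auto intro!: divide_left_mono)
      then have "(norm (z j - z k))\<^sup>2 < e\<^sup>2" using gap[of j k] K by simp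
      then show ?thesis using \<open>e > 0\<close> by (simp add: dist_norm power2_less_imp_less)
    qed
    then show "\<exists>K. \<forall>j\<ge>K. \<forall>k\<ge>K. dist (z j) (z k) < e" by blast
  qed
  then obtain p where lim: "z \<longlonglongrightarrow> p" using Cauchy_convergent convergent_def by blast
  have pS: "p \<in> S" using closed_sequentially[OF assms(2) zS lim] .
  have "(norm (x - p))\<^sup>2 \<le> d"
  proof (rule LIMSEQ_le)
    show "(\<lambda>k. (norm (x - z k))\<^sup>2) \<longlonglongrightarrow> (norm (x - p))\<^sup>2" by (intro tendsto_intros lim)
    show "(\<lambda>k. d + 1 / real (Suc k)) \<longlonglongrightarrow> d"
      using tendsto_add[OF tendsto_const[of d] LIMSEQ_inverse_real_of_nat]
      by (simp add: inverse_eq_divide)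
    show "\<exists>N. \<forall>k\<ge>N. (norm (x - z k))\<^sup>2 \<le> d + 1 / real (Suc k)" using zd less_imp_le by blast
  qed
  then have "norm (x - p) \<le> norm (x - w)" if "w \<in> S" for w
    using d_le[OF that] by (meson norm_ge_zero order_trans power2_le_imp_le)
  then show ?thesis using pS by blast
qed

lemma nearest_point:
  fixes S :: "'a::{real_inner, complete_space} set"
  assumes "convex S" "closed S" "S \<noteq> {}"
  shows nearest_point_in: "nearest_point S x \<in> S"
    and nearest_point_le: "z \<in> S \<Longrightarrow> norm (x - nearest_point S x) \<le> norm (x - z)"
proof -
  obtain p where p: "p \<in> S" "\<And>z. z \<in> S \<Longrightarrow> norm (x - p) \<le> norm (x - z)"
    using exists_nearest_point[OF assms] by blast
  have "nearest_point S x \<in> S \<and> (\<forall>z\<in>S. norm (x - nearest_point S x) \<le> norm (x - z))"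
    unfolding nearest_point_def arg_min_on_def
    by (rule arg_minI[of _ p]) (use p in \<open>auto simp: not_less\<close>)
  then show "nearest_point S x \<in> S"
    and "z \<in> S \<Longrightarrow> norm (x - nearest_point S x) \<le> norm (x - z)" by auto
qed

lemma nearest_point_orthogonal:
  fixes S :: "'a::{real_inner, complete_space} set"
  assumes "affine S" "closed S" "m \<in> S"
  shows "x - nearest_point S x \<in> ((\<lambda>z. z - m) ` S)\<^sup>\<bottom>"
  unfolding orthogonal_comp_iff
proof
  fix v assume "v \<in> (\<lambda>z. z - m) ` S"
  then obtain z where z: "z \<in> S" "v = z - m" by blast
  let ?p = "nearest_point S x"
  have conv: "convex S" using assms(1) by (rule affine_imp_convex)
  have pS: "?p \<in> S" using nearest_point_in[OF conv assms(2)] assms(3) by blast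
  have min: "\<forall>w\<in>S. dist x ?p \<le> dist x w"
    using nearest_point_le[OF conv assms(2)] assms(3) by (auto simp: dist_norm)
  \<comment> \<open>Both \<open>?p + v\<close> and \<open>?p - v\<close> lie in \<open>S\<close>, so the variational inequality holds with both signs.\<close>
  have "?p + 1 *\<^sub>R (z - m) \<in> S" "?p + 1 *\<^sub>R (m - z) \<in> S"
    using mem_affine_3_minus[OF assms(1) pS] z assms(3) by blast+
  then have "(x - ?p) \<bullet> v \<le> 0" "(x - ?p) \<bullet> (- v) \<le> 0"
    using any_closest_point_dot[OF conv assms(2) pS _ min] z by force+
  then show "(x - ?p) \<bullet> v = 0" by simp
qed

lemma subspace_decomposition:
  fixes N :: "'a::{real_inner, complete_space} set"
  assumes "subspace N" "closed N"
  obtains w1 where "w1 \<in> N" "w - w1 \<in> N\<^sup>\<bottom>"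
proof -
  have aff: "affine N" and z: "0 \<in> N"
    using assms(1) subspace_imp_affine subspace_0 by auto
  show ?thesis
    using that[of "nearest_point N w"] nearest_point_orthogonal[OF aff assms(2) z]
      nearest_point_in[OF affine_imp_convex[OF aff] assms(2)] z by auto
qed

section \<open>The Friedrichs angle\<close>

lemma friedrichs_set_bounds:
  fixes A B :: "'a::real_inner set"
  assumes "r \<in> friedrichs_set A B"
  shows "0 \<le> r" "r \<le> 1"
proof -
  obtain a b :: 'a where "r = \<bar>a \<bullet> b\<bar>" "norm a = 1" "norm b = 1"
    using assms unfolding friedrichs_set_def by blast
  then show "0 \<le> r" "r \<le> 1" using Cauchy_Schwarz_ineq2[of a b] by auto
qed

lemma friedrichs_cos_bounds: "0 \<le> friedrichs_cos A B" "friedrichs_cos A B \<le> 1"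
proof -
  have bdd: "bdd_above (friedrichs_set A B)"
    using friedrichs_set_bounds(2) by (rule bdd_aboveI)
  show "0 \<le> friedrichs_cos A B"
    using friedrichs_set_bounds(1) bdd by (auto simp: friedrichs_cos_def intro: cSup_upper2)
  show "friedrichs_cos A B \<le> 1"
    using friedrichs_set_bounds(2)[of _ A B] by (auto simp: friedrichs_cos_def intro: cSup_least)
qed

lemma inner_le_friedrichs_cos:
  assumes "subspace A" "subspace B"
    and a: "a \<in> A" "a \<in> (A \<inter> B)\<^sup>\<bottom>" and b: "b \<in> B" "b \<in> (A \<inter> B)\<^sup>\<bottom>"
  shows "\<bar>a \<bullet> b\<bar> \<le> friedrichs_cos A B * norm a * norm b"
proof (cases "a = 0 \<or> b = 0")
  case False
  let ?a = "(1 / norm a) *\<^sub>R a" and ?b = "(1 / norm b) *\<^sub>R b"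
  have "?a \<in> A \<inter> (A \<inter> B)\<^sup>\<bottom>" "?b \<in> B \<inter> (A \<inter> B)\<^sup>\<bottom>"
    using assms subspace_scale subspace_orthogonal_comp by blast+
  moreover have "norm ?a = 1" "norm ?b = 1" using False by auto
  ultimately have mem: "\<bar>?a \<bullet> ?b\<bar> \<in> friedrichs_set A B"
    unfolding friedrichs_set_def by blast
  then have "\<bar>?a \<bullet> ?b\<bar> \<le> friedrichs_cos A B"
    using friedrichs_set_bounds(2)[of _ A B]
    by (auto simp: friedrichs_cos_def intro!: cSup_upper bdd_aboveI[of _ 1])
  moreover have "\<bar>?a \<bullet> ?b\<bar> = \<bar>a \<bullet> b\<bar> / (norm a * norm b)" by (simp add: abs_mult)
  ultimately show ?thesis using False by (simp add: field_simps)
qed auto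

section \<open>Contraction of cyclic projections\<close>

text \<open>
  The iterated projections are represented by an orbit \<open>u\<close>, where \<open>u i\<close> is the orthogonal
  projection of \<open>u (i - 1)\<close> onto the subspace \<open>S i\<close>. The induction removes subspaces from the front,
  so the statement is about the final segment \<open>S (s + 1), \<dots>, S n\<close>. Subtracting a common element of
  these subspaces from an orbit yields an orbit again.
\<close>

lemma cyclic_projection_contraction:
  fixes S :: "nat \<Rightarrow> 'a::{real_inner, complete_space} set" and u :: "nat \<Rightarrow> 'a"
  assumes "s < n"
    and "\<And>i. i \<in> {s+1..n} \<Longrightarrow> subspace (S i)"
    and "\<And>i. i \<in> {s+1..n} \<Longrightarrow> closed (S i)"
    and "\<And>i. i \<in> {s+1..n} \<Longrightarrow> u i \<in> S i"
    and "\<And>i. i \<in> {s+1..n} \<Longrightarrow> u (i - 1) - u i \<in> (S i)\<^sup>\<bottom>"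
    and "u s \<in> (\<Inter>i\<in>{s+1..n}. S i)\<^sup>\<bottom>"
  shows "(norm (u n))\<^sup>2 \<le>
    (1 - (\<Prod>i=s+1..n-1. 1 - (friedrichs_cos (S i) (\<Inter>j\<in>{i+1..n}. S j))\<^sup>2)) * (norm (u s))\<^sup>2"
  using assms
proof (induction "n - s" arbitrary: s u)
  case (Suc d)
  let ?w = "u (s + 1)"
  have mem1: "s + 1 \<in> {s+1..n}" using \<open>s < n\<close> by simp
  have w: "?w \<in> S (s + 1)" "u s - ?w \<in> (S (s + 1))\<^sup>\<bottom>"
    using Suc.prems(4,5)[OF mem1] by auto
  have pyth: "(norm (u s))\<^sup>2 = (norm ?w)\<^sup>2 + (norm (u s - ?w))\<^sup>2"
    using norm_add_sq[of ?w "u s - ?w"] w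
    by (simp add: orthogonal_comp_iff inner_commute)
  show ?case
  proof (cases "n = s + 1")
    case True
    \<comment> \<open>With a single subspace left, \<open>u s\<close> is orthogonal to it and hence projected to zero.\<close>
    have "u s \<in> (S n)\<^sup>\<bottom>" using Suc.prems(6) True by simp
    moreover have "u s - u n \<in> (S n)\<^sup>\<bottom>" "u n \<in> S n" using w True by auto
    ultimately have "u n \<bullet> u n = 0" by (auto simp: orthogonal_comp_iff inner_diff_left)
    then show ?thesis using True by simp
  next
    case False
    then have sn: "s + 1 < n" using \<open>s < n\<close> by simp
    let ?N = "\<Inter>j\<in>{s+1+1..n}. S j"
    define c where "c = friedrichs_cos (S (s + 1)) ?N"
    define q where
      "q = (\<Prod>i=s+1+1..n-1. 1 - (friedrichs_cos (S i) (\<Inter>j\<in>{i+1..n}. S j))\<^sup>2)"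
    have q0: "0 \<le> q" unfolding q_def
      by (intro prod_nonneg) (auto simp: friedrichs_cos_bounds power_le_one)
    have q1: "q \<le> 1" unfolding q_def
      by (intro prod_le_1) (auto simp: friedrichs_cos_bounds power_le_one)
    have c0: "0 \<le> c" and c1: "c \<le> 1" unfolding c_def by (rule friedrichs_cos_bounds)+
    have subN: "subspace ?N" using Suc.prems(2) by (intro subspace_Inter) auto
    have clN: "closed ?N" using Suc.prems(3) by (intro closed_INT) auto
    have split: "{s+1..n} = insert (s + 1) {s+1+1..n}" using sn by auto
    have inter: "(\<Inter>i\<in>{s+1..n}. S i) = S (s + 1) \<inter> ?N" by (subst split) simp
    have w_perp: "?w \<in> (S (s + 1) \<inter> ?N)\<^sup>\<bottom>"
    proof -
      have "u s \<in> (S (s + 1) \<inter> ?N)\<^sup>\<bottom>" using Suc.prems(6) inter by simp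
      moreover have "u s - ?w \<in> (S (s + 1) \<inter> ?N)\<^sup>\<bottom>"
        using w(2) by (auto simp: orthogonal_comp_iff)
      ultimately show ?thesis by (simp add: orthogonal_comp_iff inner_diff_left)
    qed
    obtain w1 where w1: "w1 \<in> ?N" "?w - w1 \<in> ?N\<^sup>\<bottom>"
      using subspace_decomposition[OF subN clN] by blast
    have w1_perp: "w1 \<in> (S (s + 1) \<inter> ?N)\<^sup>\<bottom>"
      using w_perp w1(2) by (auto simp: orthogonal_comp_iff inner_diff_left)
    have w1_inner: "?w \<bullet> w1 = (norm w1)\<^sup>2"
      using w1 by (auto simp: orthogonal_comp_iff inner_diff_left power2_norm_eq_inner)
    have "(norm w1)\<^sup>2 \<le> c * norm ?w * norm w1"
      using inner_le_friedrichs_cos[OF Suc.prems(2)[OF mem1] subN w(1) w_perp w1(1) w1_perp]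
      unfolding w1_inner c_def by simp
    then have w1_le: "norm w1 \<le> c * norm ?w"
      using c0 by (cases "w1 = 0") (auto simp: power2_eq_square)
    have "d = n - (s + 1)" using Suc.hyps(2) by simp
    then have "(norm (u n - w1))\<^sup>2 \<le> (1 - q) * (norm (?w - w1))\<^sup>2"
      unfolding q_def
    proof (rule Suc.hyps(1)[where u = "\<lambda>i. u i - w1"])
      fix i assume i: "i \<in> {s+1+1..n}"
      then have i': "i \<in> {s+1..n}" by simp
      show "subspace (S i)" "closed (S i)" using Suc.prems(2,3)[OF i'] by auto
      show "u i - w1 \<in> S i"
        using Suc.prems(2,4)[OF i'] w1(1) i by (auto intro: subspace_diff)
      show "u (i - 1) - w1 - (u i - w1) \<in> (S i)\<^sup>\<bottom>" using Suc.prems(5)[OF i'] by simp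
    qed (use sn w1 in auto)
    moreover have "w1 \<bullet> (u n - w1) = 0"
    proof -
      \<comment> \<open>Each increment after index \<open>s + 1\<close> is orthogonal to \<open>w1\<close>, hence so is \<open>u n - u (s + 1)\<close>.\<close>
      have "w1 \<bullet> (u k - w1) = 0" if "k \<ge> s + 1" "k \<le> n" for k
        using that
      proof (induction k rule: dec_induct)
        case base
        show ?case using w1 by (auto simp: orthogonal_comp_iff inner_commute)
      next
        case (step k)
        have "u k - u (Suc k) \<in> (S (Suc k))\<^sup>\<bottom>" "w1 \<in> S (Suc k)"
          using Suc.prems(5)[of "Suc k"] w1(1) step by auto
        then have "w1 \<bullet> (u k - u (Suc k)) = 0" by (auto simp: orthogonal_comp_iff inner_commute)
        then show ?case using step by (simp add: inner_diff_right)
      qed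
      then show ?thesis using sn by simp
    qed
    then have "(norm (u n))\<^sup>2 = (norm w1)\<^sup>2 + (norm (u n - w1))\<^sup>2"
      using norm_add_sq[of w1 "u n - w1"] by simp
    moreover have "w1 \<bullet> (?w - w1) = 0" using w1 by (auto simp: orthogonal_comp_iff inner_commute)
    then have "(norm ?w)\<^sup>2 = (norm w1)\<^sup>2 + (norm (?w - w1))\<^sup>2"
      using norm_add_sq[of w1 "?w - w1"] by simp
    ultimately have "(norm (u n))\<^sup>2 \<le> (1 - q) * (norm ?w)\<^sup>2 + q * (norm w1)\<^sup>2"
      by (simp add: algebra_simps)
    also have "\<dots> \<le> (1 - q) * (norm ?w)\<^sup>2 + q * (c * norm ?w)\<^sup>2"
      using w1_le q0 by (intro add_left_mono mult_left_mono power_mono) auto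
    also have "\<dots> = (1 - (1 - c\<^sup>2) * q) * (norm ?w)\<^sup>2"
      by (simp add: algebra_simps power_mult_distrib)
    also have "\<dots> \<le> (1 - (1 - c\<^sup>2) * q) * (norm (u s))\<^sup>2"
    proof (rule mult_left_mono)
      have "(1 - c\<^sup>2) * q \<le> 1"
        using c0 c1 q0 q1 by (intro mult_le_one) (auto simp: power_le_one)
      then show "0 \<le> 1 - (1 - c\<^sup>2) * q" by simp
    qed (simp add: pyth)
    also have "(1 - c\<^sup>2) * q
        = (\<Prod>i=s+1..n-1. 1 - (friedrichs_cos (S i) (\<Inter>j\<in>{i+1..n}. S j))\<^sup>2)"
      unfolding c_def q_def using sn by (subst (2) prod.atLeast_Suc_atMost) auto
    finally show ?thesis .
  qed
qed simp

lemma rate_const_bounds: "rate_const M n \<in> {0..1}"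
  and rate_const_sq: "(rate_const M n)\<^sup>2 = 1 - (\<Prod>i=1..n-1. 1 - (angle_cos M n i)\<^sup>2)"
proof -
  have "0 \<le> (\<Prod>i=1..n-1. 1 - (angle_cos M n i)\<^sup>2)"
    by (intro prod_nonneg) (auto simp: angle_cos_def friedrichs_cos_bounds power_le_one)
  moreover have "(\<Prod>i=1..n-1. 1 - (angle_cos M n i)\<^sup>2) \<le> 1"
    by (intro prod_le_1) (auto simp: angle_cos_def friedrichs_cos_bounds power_le_one)
  ultimately show "rate_const M n \<in> {0..1}"
    and "(rate_const M n)\<^sup>2 = 1 - (\<Prod>i=1..n-1. 1 - (angle_cos M n i)\<^sup>2)"
    by (auto simp: rate_const_def)
qed

section \<open>Projections onto affine subspaces with a common point\<close>

text \<open>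
  Finitely many closed affine subspaces with a chosen common point \<open>m\<close>. Subtracting \<open>m\<close> turns
  each of them into its parallel subspace and the successive projections of a point into an orbit
  of orthogonal projections. The point \<open>m\<close> need not be the nearest one.
\<close>

locale affine_family =
  fixes M :: "nat \<Rightarrow> 'a::{real_inner, complete_space} set" and n :: nat and m :: 'a
  assumes affine: "\<And>i. i \<in> {1..n} \<Longrightarrow> affine (M i)"
    and closed: "\<And>i. i \<in> {1..n} \<Longrightarrow> closed (M i)"
    and common: "\<And>i. i \<in> {1..n} \<Longrightarrow> m \<in> M i"
begin

lemma parallel_subspace_shift:
  "i \<in> {1..n} \<Longrightarrow> parallel_subspace (M i) = (\<lambda>z. z - m) ` M i"
  by (rule parallel_subspace_eq[OF affine common])

lemma
  assumes "i \<in> {1..n}"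
  shows subspace_parallel: "subspace (parallel_subspace (M i))"
    and closed_parallel: "closed (parallel_subspace (M i))"
  unfolding parallel_subspace_shift[OF assms]
  by (rule affine_diffs_subspace_subtract[OF affine[OF assms] common[OF assms]]
      closed_translation_subtract[OF closed[OF assms]])+

lemma proj_comp_mem:
  assumes "i \<in> {1..n}"
  shows "proj_comp M i y - m \<in> parallel_subspace (M i)"
proof -
  obtain j where j: "i = Suc j" using assms by (cases i) auto
  have "proj_comp M i y \<in> M i"
    using nearest_point_in[OF affine_imp_convex[OF affine[OF assms]] closed[OF assms]]
      common[OF assms] by (auto simp: j)
  then show ?thesis by (simp add: parallel_subspace_shift[OF assms])
qed

lemma proj_comp_increment:
  assumes "i \<in> {1..n}"
  shows "proj_comp M (i - 1) y - proj_comp M i y \<in> (parallel_subspace (M i))\<^sup>\<bottom>"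
proof -
  obtain j where j: "i = Suc j" using assms by (cases i) auto
  show ?thesis
    using nearest_point_orthogonal[OF affine[OF assms] closed[OF assms] common[OF assms]]
    unfolding parallel_subspace_shift[OF assms] by (simp add: j)
qed

lemma proj_comp_contraction:
  assumes "n \<ge> 1" "y - m \<in> (\<Inter>i\<in>{1..n}. parallel_subspace (M i))\<^sup>\<bottom>"
  shows "norm (proj_comp M n y - m) \<le> rate_const M n * norm (y - m)"
proof -
  have "(norm (proj_comp M n y - m))\<^sup>2 \<le> (rate_const M n)\<^sup>2 * (norm (y - m))\<^sup>2"
    using cyclic_projection_contraction[of 0 n "\<lambda>i. parallel_subspace (M i)"
        "\<lambda>i. proj_comp M i y - m"] assms
      subspace_parallel closed_parallel proj_comp_mem proj_comp_increment
    by (simp add: rate_const_sq angle_cos_def)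
  then have "(norm (proj_comp M n y - m))\<^sup>2 \<le> (rate_const M n * norm (y - m))\<^sup>2"
    by (simp add: power_mult_distrib)
  moreover have "0 \<le> rate_const M n * norm (y - m)" using rate_const_bounds[of M n] by simp
  ultimately show ?thesis by (rule power2_le_imp_le)
qed

text \<open>Pythagoras telescoped along the orbit of projections.\<close>

lemma sum_increments:
  "k \<le> n \<Longrightarrow> (\<Sum>i=1..k. (norm (proj_comp M (i - 1) y - proj_comp M i y))\<^sup>2)
      = (norm (y - m))\<^sup>2 - (norm (proj_comp M k y - m))\<^sup>2"
proof (induction k)
  case (Suc k)
  let ?a = "proj_comp M k y - proj_comp M (Suc k) y" and ?b = "proj_comp M (Suc k) y - m"
  have "?a \<bullet> ?b = 0"
    using proj_comp_increment[of "Suc k" y] proj_comp_mem[of "Suc k" y] Suc.prems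
    by (auto simp: orthogonal_comp_iff)
  then have "(norm (proj_comp M k y - m))\<^sup>2 = (norm ?a)\<^sup>2 + (norm ?b)\<^sup>2"
    using norm_add_sq[of ?a ?b] by simp
  then show ?case using Suc by simp
qed simp

text \<open>
  The step size is an exact minimiser of the distance to \<open>m\<close> on the line through \<open>y\<close> and \<open>Q y\<close>,
  although it is computed without knowing \<open>m\<close>.
\<close>

lemma line_search_step_le:
  "norm (y + step_size M n y *\<^sub>R (proj_comp M n y - y) - m) \<le> norm (proj_comp M n y - m)"
proof (cases "proj_comp M n y = y")
  case False
  define g where "g = y - proj_comp M n y"
  define e where "e = proj_comp M n y - m"
  define t where "t = step_size M n y"
  have g0: "(norm g)\<^sup>2 > 0" using False by (simp add: g_def)
  have "t = 1/2 + ((norm (e + g))\<^sup>2 - (norm e)\<^sup>2) / (2 * (norm g)\<^sup>2)"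
    using False sum_increments[of n y] by (simp add: t_def step_size_def g_def e_def)
  \<comment> \<open>This says that the new error, \<open>e + (1 - t) *\<^sub>R g\<close>, is orthogonal to \<open>g\<close>.\<close>
  then have t: "(t - 1) * (norm g)\<^sup>2 = e \<bullet> g"
    using g0 by (simp add: norm_add_sq field_simps)
  have "y + t *\<^sub>R (proj_comp M n y - y) - m = e + (1 - t) *\<^sub>R g"
    by (simp add: e_def g_def algebra_simps)
  then have "(norm (y + t *\<^sub>R (proj_comp M n y - y) - m))\<^sup>2
      = (norm e)\<^sup>2 + 2 * (1 - t) * (e \<bullet> g) + (1 - t)\<^sup>2 * (norm g)\<^sup>2"
    by (simp add: norm_add_sq power_mult_distrib)
  also have "\<dots> = (norm e)\<^sup>2 - (t - 1)\<^sup>2 * (norm g)\<^sup>2"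
    unfolding t[symmetric] by (simp add: algebra_simps power2_eq_square)
  also have "\<dots> \<le> (norm e)\<^sup>2" by simp
  finally show ?thesis unfolding t_def e_def by (rule power2_le_imp_le) simp
qed simp

text \<open>
  Every increment of the orbit is orthogonal to one of the parallel subspaces, hence to their
  intersection, so a relaxed step of any length stays in the orthogonal complement.
\<close>

lemma step_orthogonal:
  assumes "y - m \<in> (\<Inter>i\<in>{1..n}. parallel_subspace (M i))\<^sup>\<bottom>"
  shows "y + t *\<^sub>R (proj_comp M n y - y) - m \<in> (\<Inter>i\<in>{1..n}. parallel_subspace (M i))\<^sup>\<bottom>"
proof -
  let ?N = "\<Inter>i\<in>{1..n}. parallel_subspace (M i)"
  have "proj_comp M k y - y \<in> ?N\<^sup>\<bottom>" if "k \<le> n" for k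
    using that
  proof (induction k)
    case 0
    show ?case by (simp add: orthogonal_comp_iff)
  next
    case (Suc k)
    have "proj_comp M k y - proj_comp M (Suc k) y \<in> ?N\<^sup>\<bottom>"
      using proj_comp_increment[of "Suc k" y] Suc.prems by (auto simp: orthogonal_comp_iff)
    then show ?case using Suc by (simp add: orthogonal_comp_iff inner_diff_left)
  qed
  then have "(y - m) + t *\<^sub>R (proj_comp M n y - y) \<in> ?N\<^sup>\<bottom>"
    using assms by (intro subspace_add subspace_scale subspace_orthogonal_comp) auto
  then show ?thesis by (simp add: algebra_simps)
qed

end

section \<open>Linear convergence of the accelerated method\<close>

theorem theorem4p1:
  fixes M :: "nat \<Rightarrow> 'a::{real_inner, complete_space} set"
    and n :: nat and x0 :: 'a and x :: "nat \<Rightarrow> 'a"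
  assumes "n \<ge> 1"
    and "\<And>i. i \<in> {1..n} \<Longrightarrow> affine (M i)"
    and "\<And>i. i \<in> {1..n} \<Longrightarrow> closed (M i)"
    and "(\<Inter>i\<in>{1..n}. M i) \<noteq> {}"
    and "x 0 = x0"
    and "\<And>k. x (Suc k) = x k + step_size M n (x k) *\<^sub>R (proj_comp M n (x k) - x k)"
  shows "rate_const M n \<in> {0..1} \<and>
    (\<exists>f :: nat \<Rightarrow> real. (\<forall>k. f k \<in> {0..1}) \<and>
      (\<forall>k. norm (x k - nearest_point (\<Inter>i\<in>{1..n}. M i) x0)
            \<le> norm (x0 - nearest_point (\<Inter>i\<in>{1..n}. M i) x0)
                * (\<Prod>i=1..k. f i) * rate_const M n ^ k))"
proof -
  let ?M = "\<Inter>i\<in>{1..n}. M i"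
  define m where "m = nearest_point ?M x0"
  have aff: "affine ?M" using assms(2) by blast
  have cl: "closed ?M" using assms(3) by (intro closed_INT ballI)
  have mM: "m \<in> ?M"
    unfolding m_def by (rule nearest_point_in[OF affine_imp_convex[OF aff] cl assms(4)])
  interpret affine_family M n m by unfold_locales (use assms(2,3) mM in blast)+
  let ?N = "\<Inter>i\<in>{1..n}. parallel_subspace (M i)"
  have N_sub: "?N \<subseteq> (\<lambda>z. z - m) ` ?M"
  proof
    fix v assume v: "v \<in> ?N"
    have "v + m \<in> M i" if "i \<in> {1..n}" for i
    proof -
      have "v \<in> (\<lambda>z. z - m) ` M i" using v that parallel_subspace_shift[OF that] by blast
      then show ?thesis by auto
    qed
    then show "v \<in> (\<lambda>z. z - m) ` ?M" by (intro image_eqI[of _ _ "v + m"]) auto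
  qed
  have orth: "x k - m \<in> ?N\<^sup>\<bottom>" for k
  proof (induction k)
    case 0
    have "x0 - m \<in> ((\<lambda>z. z - m) ` ?M)\<^sup>\<bottom>"
      using nearest_point_orthogonal[OF aff cl mM, of x0] unfolding m_def[symmetric] .
    then show ?case using N_sub assms(5) orthogonal_comp_anti_mono by blast
  next
    case (Suc k)
    then show ?case unfolding assms(6) by (rule step_orthogonal)
  qed
  have "norm (x k - m) \<le> norm (x0 - m) * rate_const M n ^ k" for k
  proof (induction k)
    case (Suc k)
    have "norm (x (Suc k) - m) \<le> norm (proj_comp M n (x k) - m)"
      unfolding assms(6) by (rule line_search_step_le)
    also have "\<dots> \<le> rate_const M n * norm (x k - m)"
      using assms(1) orth by (rule proj_comp_contraction)
    also have "\<dots> \<le> rate_const M n * (norm (x0 - m) * rate_const M n ^ k)"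
      using Suc rate_const_bounds[of M n] by (intro mult_left_mono) auto
    finally show ?case by (simp add: mult_ac)
  qed (simp add: assms(5))
  then show ?thesis
    unfolding m_def[symmetric]
    by (intro conjI rate_const_bounds exI[of _ "\<lambda>_. 1"]) auto
qed

end
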